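(* Let $\mathcal{S}$ be a probabilistic transition system, let $T$ be a search of $\mathcal{S}$, and let $\phi$ be an LTL$_+$ formula. Then \[ \mathrm{prog}_{\mathcal{S}}(T,\phi)=\mu_{\mathcal{S}_T}\bigl(\mathcal{B}^{\phi}_{\mathcal{S}_T}(T)\bigr). \]
   Context: A probabilistic transition system (PTS) $\mathcal{S}$ consists of a countable set $S_{\mathcal{S}}$ of states, a countable set $T_{\mathcal{S}}$ of transitions, a set $AP$ of atomic propositions, an initial state $s_0\in S_{\mathcal{S}}$, functions $\mathrm{source}_{\mathcal{S}},\mathrm{target}_{\mathcal{S}}:T_{\mathcal{S}}\to S_{\mathcal{S}}$, $\mathrm{prob}_{\mathcal{S}}:T_{\mathcal{S}}\to(0,1]$ and $\mathrm{label}_{\mathcal{S}}:S_{\mathcal{S}}\to 2^{AP}$, such that for every $s\in S_{\mathcal{S}}$, $\sum\{\mathrm{prob}_{\mathcal{S}}(t)\mid \mathrm{source}_{\mathcal{S}}(t)=s\}=1$. An execution path is an infinite sequence $t_1t_2\ldots$ of transitions with $\mathrm{source}(t_1)=s_0$ and $\mathrm{target}(t_i)=\mathrm{source}(t_{i+1})$ for all $i\ge1$; $\mathrm{Exec}_{\mathcal{S}}$ is the set of execution paths. For a finite sequence $e$ of transitions, $B^e_{\mathcal{S}}$ is the set of execution paths having $e$ as a prefix. $\mu_{\mathcal{S}}$ is the probability measure on the $\sigma$-algebra generated by these sets determined by $\mu_{\mathcal{S}}(B^{t_1\ldots t_n}_{\mathcal{S}})=\prod_{i=1}^n\mathrm{prob}_{\mathcal{S}}(t_i)$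 for finite prefixes $t_1\ldots t_n$ of execution paths. The trace of $t_1t_2\ldots$ is $\mathrm{label}(\mathrm{source}(t_1))\,\mathrm{label}(\mathrm{source}(t_2))\ldots$; for a linear-time property (set of infinite words over $2^{AP}$, LTL formulas identified with their sets of models) $\phi$, $e\models_{\mathcal{S}}\phi$ means the trace of $e$ satisfies $\phi$. A search of $\mathcal{S}$ is a finite subset $T\subseteq T_{\mathcal{S}}$. A PTS $\mathcal{S}'$ extends the search $T$ of $\mathcal{S}$ if $\mathcal{S}'$ has the same initial state and every $t\in T$ is a transition of $\mathcal{S}'$ with the same source, target and probability as in $\mathcal{S}$, and the labels of the source and target of $t$ in $\mathcal{S}'$ equal those in $\mathcal{S}$. For such $\mathcal{S}'$, $\mathcal{B}^{\phi}_{\mathcal{S}'}(T)=\bigcup\{B^e_{\mathcal{S}'}\mid e\in T^*,\ \forall e'\in B^e_{\mathcal{S}'}: e'\models_{\mathcal{S}'}\phi\}$, and $\mathrm{prog}_{\mathcal{S}}(T,\phi)=\inf\{\mu_{\mathcal{S}'}(\mathcal{B}^{\phi}_{\mathcal{S}'}(T))\mid \mathcal{S}'\text{ extends }T\text{ of }\mathcal{S}\}$. The PTS $\mathcal{S}_T$: let $S^T=\{\mathrm{source}_{\mathcal{S}}(t)\mid t\in T\}\cup\{\mathrm{target}_{\mathcal{S}}(t)\mid t\in T\}\cup\{s_0\}$ and $\mathrm{out}(s)=\sum\{\mathrm{prob}_{\mathcal{S}}(t)\mid t\in T,\ \mathrm{source}_{\mathcal{S}}(t)=s\}$. $\mathcal{S}_T$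 has states $S^T\cup\{s_\perp\}$, transitions $T\cup\{t_s\mid s\in S^T,\ \mathrm{out}(s)<1\}\cup\{t_\perp\}$, initial state $s_0$; transitions in $T$ keep their data from $\mathcal{S}$; $t_s$ goes from $s$ to $s_\perp$ with probability $1-\mathrm{out}(s)$; $t_\perp$ is a self-loop on $s_\perp$ with probability $1$; $\mathrm{label}(s_\perp)=\emptyset$, other labels as in $\mathcal{S}$. LTL$_+$ formulas: $\phi::=\mathrm{true}\mid\mathrm{false}\mid a\mid\phi\wedge\phi\mid\phi\vee\phi\mid\bigcirc\phi\mid\phi_1\mathbin{\mathcal{U}}\phi_2\mid\phi_1\mathbin{\mathcal{R}}\phi_2$ with $a\in AP$, standard LTL semantics.
   Formalization: An extension of the search must also keep the label of the initial state (else T=∅, φ=a with a in label(s_0) is a counterexample); extensions range over a fixed supply of state and transition names, into which every countable extension can be renamed. *)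

theory Defs
  imports "HOL-Probability.Probability"
begin

record ('s, 't, 'a) pts =
  states :: "'s set"
  transitions :: "'t set"
  init :: 's
  source :: "'t \<Rightarrow> 's"
  target :: "'t \<Rightarrow> 's"
  trans_prob :: "'t \<Rightarrow> real"
  label :: "'s \<Rightarrow> 'a set"

definition is_pts :: "'a set \<Rightarrow> ('s, 't, 'a) pts \<Rightarrow> bool" where
  "is_pts AP S \<longleftrightarrow>
     countable (states S) \<and> countable (transitions S) \<and> init S \<in> states S \<and>
     (\<forall>t\<in>transitions S. source S t \<in> states S \<and> target S t \<in> states S \<and>
        0 < trans_prob S t \<and> trans_prob S t \<le> 1) \<and>
     (\<forall>s\<in>states S. label S s \<subseteq> AP) \<and>
     (\<forall>s\<in>states S. (trans_prob S has_sum 1) {t \<in> transitions S. source S t = s})"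

definition exec :: "('s, 't, 'a) pts \<Rightarrow> 't stream set" where
  "exec S = {\<omega> \<in> streams (transitions S).
     source S (shd \<omega>) = init S \<and> (\<forall>i. target S (\<omega> !! i) = source S (\<omega> !! Suc i))}"

definition cyl :: "('s, 't, 'a) pts \<Rightarrow> 't list \<Rightarrow> 't stream set" where
  "cyl S e = {\<omega> \<in> exec S. stake (length e) \<omega> = e}"

definition path_measure :: "('s, 't, 'a) pts \<Rightarrow> 't stream measure" where
  "path_measure S = extend_measure (exec S) {stake n \<omega> |n \<omega>. \<omega> \<in> exec S} (cyl S)
     (\<lambda>e. ennreal (\<Prod>t\<leftarrow>e. trans_prob S t))"

definition trace :: "('s, 't, 'a) pts \<Rightarrow> 't stream \<Rightarrow> 'a set stream" where
  "trace S \<omega> = smap (\<lambda>t. label S (source S t)) \<omega>"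

text \<open>Linear-time properties are sets of infinite words.\<close>

definition good_paths :: "('s, 't, 'a) pts \<Rightarrow> 't set \<Rightarrow> 'a set stream set \<Rightarrow> 't stream set" where
  "good_paths S T P = \<Union>{cyl S e |e. e \<in> lists T \<and> (\<forall>\<omega>\<in>cyl S e. trace S \<omega> \<in> P)}"

definition search :: "('s, 't, 'a) pts \<Rightarrow> 't set \<Rightarrow> bool" where
  "search S T \<longleftrightarrow> finite T \<and> T \<subseteq> transitions S"

text \<open>
  Extensions of a search of a system over \<^typ>\<open>'s\<close> and \<^typ>\<open>'t\<close> need states and transitions
  outside the original system. They live in the following types, which contain the original
  names together with infinitely many fresh ones. A search is finite and systems are
  countable, so every extension can be renamed injectively into these types with the initial
  state and the states and transitions of the search sent to their \<^term>\<open>State\<close> and \<^term>\<open>Trans\<close>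
  copies. An extension may use the remaining \<^term>\<open>State\<close> and \<^term>\<open>Trans\<close> names in any way.
\<close>

datatype 's ext_state = State 's | Sink | FreshState nat
datatype ('s, 't) ext_trans = Trans 't | Exit 's | Loop | FreshTrans nat

text \<open>
  ``The same initial state'' includes its label. This clause only matters if the initial state
  is not an endpoint of a transition in \<^term>\<open>T\<close>, for instance if \<^term>\<open>T\<close> is empty.
\<close>

definition extends ::
  "('s ext_state, ('s, 't) ext_trans, 'a) pts \<Rightarrow> ('s, 't, 'a) pts \<Rightarrow> 't set \<Rightarrow> bool" where
  "extends S' S T \<longleftrightarrow>
     init S' = State (init S) \<and> label S' (init S') = label S (init S) \<and>
     (\<forall>t\<in>T. Trans t \<in> transitions S' \<and>
        source S' (Trans t) = State (source S t) \<and>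
        target S' (Trans t) = State (target S t) \<and>
        trans_prob S' (Trans t) = trans_prob S t \<and>
        label S' (source S' (Trans t)) = label S (source S t) \<and>
        label S' (target S' (Trans t)) = label S (target S t))"

definition prog :: "'a set \<Rightarrow> ('s, 't, 'a) pts \<Rightarrow> 't set \<Rightarrow> 'a set stream set \<Rightarrow> real" where
  "prog AP S T P =
     Inf {measure (path_measure S') (good_paths S' (Trans ` T) P) |S'.
       is_pts AP S' \<and> extends S' S T}"

definition search_states :: "('s, 't, 'a) pts \<Rightarrow> 't set \<Rightarrow> 's set" where
  "search_states S T = source S ` T \<union> target S ` T \<union> {init S}"

definition out :: "('s, 't, 'a) pts \<Rightarrow> 't set \<Rightarrow> 's \<Rightarrow> real" where
  "out S T s = (\<Sum>t | t \<in> T \<and> source S t = s. trans_prob S t)"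

text \<open>
  \<^term>\<open>Sink\<close>, \<^term>\<open>Exit s\<close> and \<^term>\<open>Loop\<close> are $s_\perp$, $t_s$ and $t_\perp$.
\<close>

definition search_pts ::
  "('s, 't, 'a) pts \<Rightarrow> 't set \<Rightarrow> ('s ext_state, ('s, 't) ext_trans, 'a) pts" where
  "search_pts S T =
     \<lparr>states = State ` search_states S T \<union> {Sink},
      transitions = Trans ` T \<union> Exit ` {s \<in> search_states S T. out S T s < 1} \<union> {Loop},
      init = State (init S),
      source = (\<lambda>x. case x of Trans t \<Rightarrow> State (source S t) | Exit s \<Rightarrow> State s | _ \<Rightarrow> Sink),
      target = (\<lambda>x. case x of Trans t \<Rightarrow> State (target S t) | _ \<Rightarrow> Sink),
      trans_prob = (\<lambda>x. case x of Trans t \<Rightarrow> trans_prob S t | Exit s \<Rightarrow> 1 - out S T s | _ \<Rightarrow> 1),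
      label = (\<lambda>x. case x of State s \<Rightarrow> label S s | _ \<Rightarrow> {})\<rparr>"

datatype (atoms: 'a) ltlp =
    TrueP
  | FalseP
  | Atom 'a
  | And "'a ltlp" "'a ltlp"
  | Or "'a ltlp" "'a ltlp"
  | Next "'a ltlp"
  | Until "'a ltlp" "'a ltlp"
  | Release "'a ltlp" "'a ltlp"

primrec sat :: "'a ltlp \<Rightarrow> 'a set stream \<Rightarrow> bool" where
  "sat TrueP w \<longleftrightarrow> True"
| "sat FalseP w \<longleftrightarrow> False"
| "sat (Atom a) w \<longleftrightarrow> a \<in> shd w"
| "sat (And \<phi> \<psi>) w \<longleftrightarrow> sat \<phi> w \<and> sat \<psi> w"
| "sat (Or \<phi> \<psi>) w \<longleftrightarrow> sat \<phi> w \<or> sat \<psi> w"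
| "sat (Next \<phi>) w \<longleftrightarrow> sat \<phi> (stl w)"
| "sat (Until \<phi> \<psi>) w \<longleftrightarrow> (\<exists>j. sat \<psi> (sdrop j w) \<and> (\<forall>i<j. sat \<phi> (sdrop i w)))"
| "sat (Release \<phi> \<psi>) w \<longleftrightarrow> (\<forall>j. sat \<psi> (sdrop j w) \<or> (\<exists>i<j. sat \<phi> (sdrop i w)))"

definition models :: "'a set \<Rightarrow> 'a ltlp \<Rightarrow> 'a set stream set" where
  "models AP \<phi> = {w \<in> streams (Pow AP). sat \<phi> w}"

end

theory Submission
  imports Defs
begin

text \<open>
  The system \<^term>\<open>search_pts S T\<close> itself extends the search, so it suffices to compare it with an
  arbitrary extension \<open>S'\<close>. Cutting an execution of \<open>S'\<close> off at its first transition outside the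
  search and escaping to the sink gives an execution of \<^term>\<open>search_pts S T\<close> with a pointwise
  smaller trace. Negation-free LTL is monotone in the trace, hence every good prefix for
  \<^term>\<open>search_pts S T\<close> is good for \<open>S'\<close>. A union of cylinders of words over the search has the
  same measure in both systems: it is the sum of the weights of the prefix-minimal words.
  That \<^const>\<open>path_measure\<close> is not the junk value of \<^const>\<open>extend_measure\<close> follows from the
  Ionescu-Tulcea theorem: the complement of the executions is a countable union of
  cylinders of measure zero.
\<close>

section \<open>Words, streams and the one-step distribution\<close>

lemma prod_list_conv_prod:
  fixes xs :: "'b :: comm_monoid_mult list"
  shows "prod_list xs = (\<Prod>i<length xs. xs ! i)"
  by (induction xs) (simp_all add: prod.lessThan_Suc_shift del: prod.lessThan_Suc)

lemma snth_to_stream: "to_stream x !! i = x i"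
  by (simp add: to_stream_def)

lemma stake_eq_iff_snth: "stake (length e) \<omega> = e \<longleftrightarrow> (\<forall>i<length e. \<omega> !! i = e ! i)"
  by (auto simp: list_eq_iff_nth_eq)

text \<open>The state in which the transition at position \<open>i\<close> has to start. The
  argument is a bare function, so that one formula serves lists via \<open>(!)\<close>, streams via
  \<open>(!!)\<close> and points of product spaces.\<close>

definition step_source :: "('s, 't, 'a) pts \<Rightarrow> nat \<Rightarrow> (nat \<Rightarrow> 't) \<Rightarrow> 's" where
  "step_source S i x = (if i = 0 then init S else target S (x (i - 1)))"

text \<open>Transitions not leaving \<open>s\<close> stay in the space with density zero, so that
  all kernels of the walk share one measurable space.\<close>

definition step_dist :: "('s, 't, 'a) pts \<Rightarrow> 's \<Rightarrow> 't measure" where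
  "step_dist S s = density (count_space (transitions S))
     (\<lambda>t. if source S t = s then ennreal (trans_prob S t) else 0)"

text \<open>A purely local condition on the word; \<open>is_path_iff_prefix\<close> identifies it
  with being a prefix of an execution.\<close>

definition is_path :: "('s, 't, 'a) pts \<Rightarrow> 't list \<Rightarrow> bool" where
  "is_path S e \<longleftrightarrow> e \<in> lists (transitions S) \<and>
     (\<forall>i<length e. source S (e ! i) = step_source S i ((!) e))"

locale prob_transition_system =
  fixes AP :: "'a set" and S :: "('s, 't, 'a) pts"
  assumes is_pts: "is_pts AP S"
begin

lemma countable_transitions: "countable (transitions S)"
  and init_in_states: "init S \<in> states S"
  and target_in_states: "t \<in> transitions S \<Longrightarrow> target S t \<in> states S"
  and source_in_states: "t \<in> transitions S \<Longrightarrow> source S t \<in> states S"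
  and trans_prob_pos: "t \<in> transitions S \<Longrightarrow> 0 < trans_prob S t"
  and label_subset: "s \<in> states S \<Longrightarrow> label S s \<subseteq> AP"
  and trans_prob_has_sum:
    "s \<in> states S \<Longrightarrow> (trans_prob S has_sum 1) {t \<in> transitions S. source S t = s}"
  using is_pts by (auto simp: is_pts_def)

lemma space_step_dist [simp]: "space (step_dist S s) = transitions S"
  and sets_step_dist [simp]: "sets (step_dist S s) = Pow (transitions S)"
  by (simp_all add: step_dist_def)

lemma emeasure_step_dist_singleton:
  assumes "t \<in> transitions S"
  shows "emeasure (step_dist S s) {t} = (if source S t = s then ennreal (trans_prob S t) else 0)"
  using assms by (simp add: step_dist_def emeasure_density)

lemma prob_space_step_dist:
  assumes "s \<in> states S"
  shows "prob_space (step_dist S s)"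
proof
  let ?A = "{t \<in> transitions S. source S t = s}"
  note has_sum = trans_prob_has_sum[OF assms]
  \<comment> \<open>Positivity of the summands gives absolute summability, which leads from
    \<open>has_sum\<close> via \<open>infsetsum\<close> to an integral.\<close>
  have "(\<lambda>t. norm (trans_prob S t)) summable_on ?A"
    using has_sum_imp_summable[OF has_sum] trans_prob_pos
    by (subst summable_on_cong[where g = "trans_prob S"]) (auto simp: less_imp_le)
  then have abs: "Infinite_Set_Sum.abs_summable_on (trans_prob S) ?A"
    by (rule abs_summable_equivalent[THEN iffD1])
  have "emeasure (step_dist S s) (space (step_dist S s)) =
      (\<integral>\<^sup>+t. (if source S t = s then ennreal (trans_prob S t) else 0) \<partial>count_space (transitions S))"
    by (simp add: step_dist_def emeasure_density cong: nn_integral_cong_simp)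
  also have "\<dots> = (\<integral>\<^sup>+t. ennreal (trans_prob S t) \<partial>count_space ?A)"
    by (subst (1 2) nn_integral_count_space_indicator)
       (auto intro!: nn_integral_cong split: split_indicator)
  also have "\<dots> = ennreal (infsetsum (trans_prob S) ?A)"
    using abs trans_prob_pos by (intro nn_integral_conv_infsetsum) (auto intro: less_imp_le)
  also have "infsetsum (trans_prob S) ?A = 1"
    using infsetsum_infsum[OF abs] infsumI[OF has_sum] by simp
  also have "ennreal 1 = 1"
    by simp
  finally show "emeasure (step_dist S s) (space (step_dist S s)) = 1" .
qed

lemma step_source_in_states:
  "x \<in> space (PiM {0..<n} (\<lambda>_. count_space (transitions S))) \<Longrightarrow> step_source S n x \<in> states S"
  by (auto simp: step_source_def space_PiM PiE_iff init_in_states target_in_states)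

end

section \<open>The random walk, by the Ionescu-Tulcea theorem\<close>

sublocale prob_transition_system \<subseteq> walk: Ionescu_Tulcea
  "\<lambda>n x. step_dist S (step_source S n x)" "\<lambda>_. count_space (transitions S)"
proof (rule Ionescu_Tulcea.intro)
  show "prob_space (step_dist S (step_source S n x))"
    if "x \<in> space (PiM {0..<n} (\<lambda>_. count_space (transitions S)))" for n x
    using that by (intro prob_space_step_dist step_source_in_states)
  show "(\<lambda>x. step_dist S (step_source S n x)) \<in>
      PiM {0..<n} (\<lambda>_. count_space (transitions S)) \<rightarrow>\<^sub>M subprob_algebra (count_space (transitions S))" for n
  proof (cases n)
    case 0
    then show ?thesis
      by (auto simp: step_source_def space_subprob_algebra init_in_states
          intro!: prob_space_imp_subprob_space prob_space_step_dist measurable_const)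
  next
    case (Suc m)
    \<comment> \<open>The kernel sees the history only through its last coordinate, which ranges
      over a discrete space.\<close>
    have "(\<lambda>t. step_dist S (target S t)) \<in>
        count_space (transitions S) \<rightarrow>\<^sub>M subprob_algebra (count_space (transitions S))"
      by (auto simp: space_subprob_algebra target_in_states
          intro!: prob_space_imp_subprob_space prob_space_step_dist)
    moreover have "(\<lambda>x. x m) \<in>
        PiM {0..<n} (\<lambda>_. count_space (transitions S)) \<rightarrow>\<^sub>M count_space (transitions S)"
      using Suc by (intro measurable_component_singleton) auto
    ultimately show ?thesis
      using Suc measurable_compose by (fastforce simp: step_source_def simp del: measurable_count_space_eq1)
  qed
qed

context prob_transition_system
begin

abbreviation "step_weight i x \<equiv>
  if source S (x i) = step_source S i x then ennreal (trans_prob S (x i)) else 0"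

lemma sets_PiM_singleton:
  fixes n :: nat
  assumes "x \<in> {0..<n} \<rightarrow>\<^sub>E transitions S"
  shows "{x} \<in> sets (PiM {0..<n} (\<lambda>_. count_space (transitions S)))"
proof -
  have "{x} = (\<Pi>\<^sub>E i\<in>{0..<n}. {x i})"
    using assms by (simp add: PiE_singleton PiE_iff)
  also have "\<dots> \<in> sets (PiM {0..<n} (\<lambda>_. count_space (transitions S)))"
    using assms by (intro sets_PiM_I_finite) (auto simp: PiE_iff)
  finally show ?thesis .
qed

text \<open>Induction on the number of steps: each kernel contributes one factor.\<close>

lemma emeasure_walk_C:
  assumes "x \<in> {0..<n} \<rightarrow>\<^sub>E transitions S"
  shows "emeasure (walk.C 0 n (\<lambda>_. undefined)) {x} = (\<Prod>i<n. step_weight i x)"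
  using assms
proof (induction n arbitrary: x)
  case 0
  then show ?case
    by (auto simp: sets_PiM_singleton[of x 0, simplified])
next
  case (Suc n)
  let ?M = "\<lambda>n. PiM {0..<n::nat} (\<lambda>_. count_space (transitions S))"
  let ?C = "walk.C 0 n (\<lambda>_. undefined)"
  let ?y = "restrict x {0..<n}"
  have y: "?y \<in> {0..<n} \<rightarrow>\<^sub>E transitions S"
    using Suc.prems by auto
  have x [measurable]: "{x} \<in> sets (?M (Suc n))"
    by (rule sets_PiM_singleton) fact
  \<comment> \<open>The empty history: the only extensional function on the empty index set.\<close>
  have 0: "(\<lambda>_. undefined) \<in> space (?M 0)"
    by (auto simp: space_PiM)
  \<comment> \<open>Prolonging \<open>z\<close> by one transition reaches \<open>x\<close> only if
    \<open>z\<close> is the restriction \<open>?y\<close>, so the integral over histories collapses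
    to a single point.\<close>
  have eP: "emeasure (walk.eP n z) {x} =
      emeasure (step_dist S (step_source S n ?y)) {x n} * indicator {?y} z"
    if z: "z \<in> space (?M n)" for z
  proof -
    have "(\<lambda>t. z(n := t)) -` {x} \<inter> transitions S = (if z = ?y then {x n} else {})"
    proof -
      have upd: "z(n := t) = x \<longleftrightarrow> z = ?y \<and> t = x n" for t
      proof
        assume "z(n := t) = x"
        moreover have "z = restrict (z(n := t)) {0..<n}"
          using z by (auto simp: space_PiM PiE_iff extensional_def restrict_def)
        ultimately show "z = ?y \<and> t = x n"
          by (metis fun_upd_same)
      next
        assume "z = ?y \<and> t = x n"
        then show "z(n := t) = x"
          using Suc.prems by (auto simp: PiE_iff extensional_def restrict_def)
      qed
      have xn: "x n \<in> transitions S"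
        using Suc.prems by auto
      show ?thesis
        unfolding vimage_def singleton_iff upd using xn by (cases "z = ?y") auto
    qed
    then show ?thesis
      by (subst walk.emeasure_eP[OF z x]) auto
  qed
  have "emeasure (walk.C 0 (Suc n) (\<lambda>_. undefined)) {x} = (\<integral>\<^sup>+z. emeasure (walk.eP n z) {x} \<partial>?C)"
  proof -
    have "space ?C \<noteq> {}"
      using walk.prob_space_C[OF 0] by (rule prob_space.not_empty)
    moreover have "walk.eP n \<in> ?C \<rightarrow>\<^sub>M subprob_algebra (?M (Suc n))"
      using walk.measurable_eP[of n] walk.sets_C[OF 0, of n] by (simp cong: measurable_cong_sets)
    ultimately show ?thesis
      using x by (simp add: emeasure_bind)
  qed
  also have "\<dots> = (\<integral>\<^sup>+z. emeasure (step_dist S (step_source S n ?y)) {x n} * indicator {?y} z \<partial>?C)"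
    by (intro nn_integral_cong eP) (use 0 in \<open>auto simp: walk.space_C\<close>)
  also have "\<dots> = emeasure (step_dist S (step_source S n ?y)) {x n} * emeasure ?C {?y}"
    using sets_PiM_singleton[OF y] 0
    by (subst nn_integral_cmult_indicator) (auto simp: walk.sets_C)
  also have "\<dots> = step_weight n x * (\<Prod>i<n. step_weight i ?y)"
    using Suc.prems by (subst Suc.IH[OF y], subst emeasure_step_dist_singleton)
      (auto simp: step_source_def)
  also have "(\<Prod>i<n. step_weight i ?y) = (\<Prod>i<n. step_weight i x)"
    by (intro prod.cong) (auto simp: step_source_def)
  finally show ?case
    by (simp add: mult.commute)
qed

text \<open>The law of the walk on all streams over the transitions, executions or not. It later
  witnesses that \<open>path_measure\<close> takes the prescribed values.\<close>

definition stream_measure :: "'t stream measure" where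
  "stream_measure = distr walk.PF.lim (stream_space (count_space (transitions S))) to_stream"

lemma space_stream_measure [simp]: "space stream_measure = streams (transitions S)"
  and sets_stream_measure [measurable_cong]:
    "sets stream_measure = sets (stream_space (count_space (transitions S)))"
  by (simp_all add: stream_measure_def space_stream_space)

definition stream_cyl :: "'t list \<Rightarrow> 't stream set" where
  "stream_cyl e = {\<omega> \<in> streams (transitions S). stake (length e) \<omega> = e}"

lemma stream_cyl_measurable:
  "stream_cyl e \<in> sets stream_measure"
proof -
  have *: "{\<omega> \<in> space stream_measure. \<omega> !! i = e ! i} \<in> sets stream_measure" for i
  proof -
    have "{\<omega> \<in> space stream_measure. \<omega> !! i = e ! i} =
       (\<lambda>\<omega>. \<omega> !! i) -` ({e ! i} \<inter> transitions S) \<inter> space stream_measure"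
      by (auto simp: streams_iff_snth)
    also have "\<dots> \<in> sets stream_measure"
      by (rule measurable_sets[where A = "count_space (transitions S)"]) auto
    finally show ?thesis .
  qed
  have "stream_cyl e = {\<omega> \<in> space stream_measure. \<forall>i\<in>{..<length e}. \<omega> !! i = e ! i}"
    by (auto simp: stream_cyl_def stake_eq_iff_snth)
  also have "\<dots> \<in> sets stream_measure"
    by (intro sets.sets_Collect_finite_All * finite_lessThan)
  finally show ?thesis .
qed

lemma emeasure_stream_cyl:
  assumes e: "e \<in> lists (transitions S)"
  shows "emeasure stream_measure (stream_cyl e) =
    (if is_path S e then ennreal (\<Prod>t\<leftarrow>e. trans_prob S t) else 0)"
proof -
  let ?n = "length e"
  \<comment> \<open>The word as a point of the finite product, whose elements are
    extensional.\<close>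
  let ?x = "restrict ((!) e) {0..<?n}"
  have x: "?x \<in> {0..<?n} \<rightarrow>\<^sub>E transitions S"
    using e by (auto simp: lists_eq_set)
  have vimage: "to_stream -` stream_cyl e \<inter> space (PiM UNIV (\<lambda>_. count_space (transitions S))) =
      prod_emb UNIV (\<lambda>_. count_space (transitions S)) {0..<?n} {?x}"
    by (auto simp: stream_cyl_def stake_eq_iff_snth prod_emb_def space_PiM to_stream_in_streams
        snth_to_stream fun_eq_iff restrict_def PiE_iff)
      (metis (full_types))
  have "emeasure stream_measure (stream_cyl e) =
      emeasure walk.PF.lim (prod_emb UNIV (\<lambda>_. count_space (transitions S)) {0..<?n} {?x})"
    using stream_cyl_measurable unfolding stream_measure_def
    by (subst emeasure_distr) (auto simp: vimage cong: measurable_cong_sets)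
  also have "\<dots> = emeasure (walk.CI {0..<?n}) {?x}"
    by (intro walk.lim sets_PiM_singleton x) simp
  also have "\<dots> = emeasure (walk.C 0 ?n (\<lambda>_. undefined)) {?x}"
    using x by (subst walk.emeasure_CI[of _ ?n])
      (auto simp: sets_PiM_singleton intro!: arg_cong[where f = "emeasure _"] prod_emb_id)
  also have "\<dots> = (\<Prod>i<?n. step_weight i ?x)"
    by (rule emeasure_walk_C[OF x])
  also have "\<dots> = (\<Prod>i<?n. step_weight i ((!) e))"
    by (intro prod.cong) (auto simp: step_source_def)
  also have "\<dots> = (if is_path S e then ennreal (\<Prod>t\<leftarrow>e. trans_prob S t) else 0)"
  proof (cases "is_path S e")
    case True
    then have "(\<Prod>i<?n. step_weight i ((!) e)) = (\<Prod>i<?n. ennreal (trans_prob S (e ! i)))"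
      by (intro prod.cong) (auto simp: is_path_def)
    also have "\<dots> = ennreal (\<Prod>i<?n. trans_prob S (e ! i))"
      using e by (intro prod_ennreal less_imp_le trans_prob_pos) (auto simp: lists_eq_set)
    also have "(\<Prod>i<?n. trans_prob S (e ! i)) = (\<Prod>t\<leftarrow>e. trans_prob S t)"
      by (simp add: prod_list_conv_prod atLeast0LessThan)
    finally show ?thesis using True by simp
  next
    case False
    \<comment> \<open>All letters are transitions, so the failure is a source mismatch at some
      position, and the factor there is zero.\<close>
    then show ?thesis using e by (auto simp: is_path_def)
  qed
  finally show ?thesis .
qed

section \<open>The executions have full measure\<close>

lemma exec_iff_is_path: "\<omega> \<in> exec S \<longleftrightarrow> (\<forall>n. is_path S (stake n \<omega>))"
proof
  assume "\<omega> \<in> exec S"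
  then show "\<forall>n. is_path S (stake n \<omega>)"
    by (auto simp: exec_def is_path_def step_source_def streams_iff_snth in_set_conv_nth
        gr0_conv_Suc)
next
  assume path: "\<forall>n. is_path S (stake n \<omega>)"
  have "\<omega> !! i \<in> transitions S \<and> source S (\<omega> !! i) = step_source S i ((!!) \<omega>)" for i
  proof -
    have p: "is_path S (stake (Suc i) \<omega>)"
      using path by blast
    then have "stake (Suc i) \<omega> ! i \<in> transitions S"
      unfolding is_path_def lists_eq_set using nth_mem[of i "stake (Suc i) \<omega>"]
      by (auto simp del: stake.simps)
    moreover from p have "source S (stake (Suc i) \<omega> ! i) = step_source S i ((!) (stake (Suc i) \<omega>))"
      unfolding is_path_def by (auto simp del: stake.simps)
    moreover have "step_source S i ((!) (stake (Suc i) \<omega>)) = step_source S i ((!!) \<omega>)"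
      by (simp add: step_source_def del: stake.simps)
    ultimately show ?thesis
      by (simp del: stake.simps)
  qed
  from this[of 0] this[of "Suc i" for i] this show "\<omega> \<in> exec S"
    by (auto simp: exec_def streams_iff_snth step_source_def)
qed

lemma exec_subset_streams: "exec S \<subseteq> streams (transitions S)"
  by (auto simp: exec_def)

lemma streams_diff_exec:
  "streams (transitions S) - exec S =
     (\<Union>e\<in>{e \<in> lists (transitions S). \<not> is_path S e}. stream_cyl e)"
proof (intro equalityI subsetI)
  fix \<omega> assume "\<omega> \<in> streams (transitions S) - exec S"
  moreover from this obtain n where "\<not> is_path S (stake n \<omega>)"
    by (auto simp: exec_iff_is_path)
  ultimately show "\<omega> \<in> (\<Union>e\<in>{e \<in> lists (transitions S). \<not> is_path S e}. stream_cyl e)"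
    by (intro UN_I[of "stake n \<omega>"])
       (auto simp: stream_cyl_def lists_eq_set streams_iff_snth in_set_conv_nth)
next
  fix \<omega> assume "\<omega> \<in> (\<Union>e\<in>{e \<in> lists (transitions S). \<not> is_path S e}. stream_cyl e)"
  then show "\<omega> \<in> streams (transitions S) - exec S"
    by (auto simp: stream_cyl_def exec_iff_is_path) metis
qed

lemma streams_diff_exec_null: "streams (transitions S) - exec S \<in> null_sets stream_measure"
  unfolding streams_diff_exec
proof (rule null_sets_UN')
  show "countable {e \<in> lists (transitions S). \<not> is_path S e}"
    by (rule countable_subset[OF _ countable_lists[OF countable_transitions]]) auto
qed (auto simp: null_sets_def stream_cyl_measurable emeasure_stream_cyl)

text \<open>Removing a null set changes neither measurability nor measure, so both carry over from
  \<open>stream_cyl\<close>.\<close>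

lemma cyl_eq_stream_cyl: "cyl S e = stream_cyl e - (streams (transitions S) - exec S)"
  using exec_subset_streams by (auto simp: cyl_def stream_cyl_def)

lemma cyl_measurable_stream: "cyl S e \<in> sets stream_measure"
  unfolding cyl_eq_stream_cyl using streams_diff_exec_null stream_cyl_measurable
  by (intro sets.Diff[OF stream_cyl_measurable]) (rule null_setsD2)

lemma emeasure_stream_measure_cyl:
  assumes "is_path S e"
  shows "emeasure stream_measure (cyl S e) = ennreal (\<Prod>t\<leftarrow>e. trans_prob S t)"
  using assms unfolding cyl_eq_stream_cyl
  by (subst emeasure_Diff_null_set)
     (auto simp: streams_diff_exec_null stream_cyl_measurable emeasure_stream_cyl is_path_def)

lemma prod_trans_prob_pos:
  assumes "e \<in> lists (transitions S)"
  shows "0 < (\<Prod>t\<leftarrow>e. trans_prob S t)"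
  using assms by (induction e) (auto simp: trans_prob_pos)

text \<open>A path is prolonged to an execution without constructing one: its cylinder has positive
  measure and hence is nonempty.\<close>

lemma is_path_iff_prefix: "is_path S e \<longleftrightarrow> (\<exists>\<omega>\<in>exec S. stake (length e) \<omega> = e)"
proof
  assume e: "is_path S e"
  have "emeasure stream_measure (cyl S e) \<noteq> 0"
    using e prod_trans_prob_pos[of e] by (simp add: emeasure_stream_measure_cyl is_path_def)
  then have "cyl S e \<noteq> {}"
    by auto
  then show "\<exists>\<omega>\<in>exec S. stake (length e) \<omega> = e"
    by (auto simp: cyl_def)
next
  assume "\<exists>\<omega>\<in>exec S. stake (length e) \<omega> = e"
  then show "is_path S e"
    by (auto simp: exec_iff_is_path) metis
qed

lemma prefixes_eq: "{stake n \<omega> |n \<omega>. \<omega> \<in> exec S} = {e. is_path S e}"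
  by (auto simp: is_path_iff_prefix) (metis length_stake)+

lemma cyl_subset_exec: "cyl S e \<subseteq> exec S"
  by (auto simp: cyl_def)

section \<open>The path measure on cylinders and their unions\<close>

lemma sets_path_measure:
  "sets (path_measure S) = sigma_sets (exec S) (cyl S ` {e. is_path S e})"
  unfolding path_measure_def prefixes_eq using cyl_subset_exec by (intro sets_extend_measure) auto

lemma space_path_measure: "space (path_measure S) = exec S"
  unfolding path_measure_def prefixes_eq using cyl_subset_exec by (intro space_extend_measure) auto

lemma cyl_measurable: "cyl S e \<in> sets (path_measure S)"
proof (cases "is_path S e")
  case True
  then show ?thesis by (auto simp: sets_path_measure)
next
  case False
  then have "cyl S e = {}" by (auto simp: cyl_def is_path_iff_prefix)
  then show ?thesis by simp
qed

text \<open>Makes \<open>emeasure stream_measure\<close> countably additive on the generated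
  sigma-algebra, as the extension in \<open>emeasure_cyl\<close> requires. The detour through
  \<open>restrict_space\<close> is due to the smaller space \<open>exec S\<close>.\<close>

lemma sets_path_measure_subset: "sets (path_measure S) \<subseteq> sets stream_measure"
proof -
  have exec: "exec S \<in> sets stream_measure"
    using cyl_measurable_stream[of "[]"] by (simp add: cyl_def)
  have "cyl S ` {e. is_path S e} \<subseteq> sets (restrict_space stream_measure (exec S))"
    using exec cyl_measurable_stream cyl_subset_exec
    by (auto simp: sets_restrict_space_iff Int_absorb2[OF exec_subset_streams])
  then have "sigma_sets (space (restrict_space stream_measure (exec S))) (cyl S ` {e. is_path S e}) \<subseteq>
      sets (restrict_space stream_measure (exec S))"
    by (rule sets.sigma_sets_subset)
  also have "space (restrict_space stream_measure (exec S)) = exec S"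
    using exec_subset_streams by (auto simp: space_restrict_space)
  finally show ?thesis
    unfolding sets_path_measure using exec
    by (auto simp: sets_restrict_space_iff Int_absorb2[OF exec_subset_streams])
qed

lemma emeasure_cyl:
  assumes "is_path S e"
  shows "emeasure (path_measure S) (cyl S e) = ennreal (\<Prod>t\<leftarrow>e. trans_prob S t)"
proof (rule emeasure_extend_measure[where \<mu>' = "emeasure stream_measure"
      and I = "{stake n \<omega> |n \<omega>. \<omega> \<in> exec S}"])
  show "path_measure S = extend_measure (exec S) {stake n \<omega> |n \<omega>. \<omega> \<in> exec S} (cyl S)
      (\<lambda>e. ennreal (\<Prod>t\<leftarrow>e. trans_prob S t))"
    by (rule path_measure_def)
  show "positive (sets (path_measure S)) (emeasure stream_measure)"
    by (simp add: positive_def)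
  show "countably_additive (sets (path_measure S)) (emeasure stream_measure)"
    using sets_path_measure_subset
    by (auto simp: countably_additive_def intro!: suminf_emeasure)
qed (use assms cyl_subset_exec in \<open>auto simp: emeasure_stream_measure_cyl prefixes_eq\<close>)

lemma prob_space_path_measure: "prob_space (path_measure S)"
proof
  have "is_path S []" by (simp add: is_path_def)
  from emeasure_cyl[OF this] show "emeasure (path_measure S) (space (path_measure S)) = 1"
    by (simp add: space_path_measure cyl_def)
qed

text \<open>The right-hand side involves the system only through the weights of words, so that two
  systems can be compared on the same set \<open>E\<close>.\<close>

lemma emeasure_UN_cyl:
  assumes E: "\<And>e. e \<in> E \<Longrightarrow> is_path S e"
  shows "emeasure (path_measure S) (\<Union>e\<in>E. cyl S e) =
    (\<integral>\<^sup>+e. ennreal (\<Prod>t\<leftarrow>e. trans_prob S t) \<partial>count_space {e \<in> E. \<forall>k<length e. take k e \<notin> E})"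
proof -
  let ?E = "{e \<in> E. \<forall>k<length e. take k e \<notin> E}"
  \<comment> \<open>The cylinders of the prefix-minimal elements of \<open>E\<close> partition the union.\<close>
  have "(\<Union>e\<in>E. cyl S e) = (\<Union>e\<in>?E. cyl S e)"
  proof (intro equalityI subsetI)
    fix \<omega> assume "\<omega> \<in> (\<Union>e\<in>E. cyl S e)"
    then have \<omega>: "\<omega> \<in> exec S" and ex: "\<exists>n. stake n \<omega> \<in> E"
      by (auto simp: cyl_def) metis
    \<comment> \<open>The shortest prefix lying in \<open>E\<close> is prefix-minimal.\<close>
    let ?n = "LEAST n. stake n \<omega> \<in> E"
    have "stake ?n \<omega> \<in> E"
      using ex by (rule LeastI_ex)
    moreover have "take k (stake ?n \<omega>) \<notin> E" if "k < ?n" for k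
      using not_less_Least[OF that] that by (simp add: take_stake min_absorb1)
    ultimately show "\<omega> \<in> (\<Union>e\<in>?E. cyl S e)"
      using \<omega> by (intro UN_I[of "stake ?n \<omega>"]) (auto simp: cyl_def)
  qed auto
  moreover have "disjoint_family_on (cyl S) ?E"
  proof -
    have "e = e'" if "e \<in> ?E" "e' \<in> ?E" "\<omega> \<in> cyl S e" "\<omega> \<in> cyl S e'" for e e' \<omega>
      using that
    proof (induction "length e" "length e'" arbitrary: e e' rule: linorder_wlog)
      case le
      \<comment> \<open>Of two prefixes of one stream the shorter is a prefix of the longer;
        minimality of \<open>e'\<close> then excludes a strict one.\<close>
      have "e = take (length e) e'"
        using le by (auto simp: cyl_def take_stake min_absorb1 dest: arg_cong[where f = "take (length e)"])
      with le show ?case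
        by (cases "length e < length e'") auto
    qed auto
    then show ?thesis
      unfolding disjoint_family_on_def by blast
  qed
  moreover have "countable ?E"
    by (rule countable_subset[OF _ countable_lists[OF countable_transitions]])
       (use E in \<open>auto simp: is_path_def\<close>)
  ultimately have "emeasure (path_measure S) (\<Union>e\<in>E. cyl S e) =
      (\<integral>\<^sup>+e. emeasure (path_measure S) (cyl S e) \<partial>count_space ?E)"
    by (simp add: emeasure_UN_countable cyl_measurable)
  also have "\<dots> = (\<integral>\<^sup>+e. ennreal (\<Prod>t\<leftarrow>e. trans_prob S t) \<partial>count_space ?E)"
    by (intro nn_integral_cong emeasure_cyl) (auto intro: E)
  finally show ?thesis .
qed

text \<open>Guards the final comparison: a non-measurable set would receive the default measure 0.
  The union is countable because \<open>lists T\<close> is.\<close>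

lemma good_paths_measurable:
  assumes "countable T"
  shows "good_paths S T P \<in> sets (path_measure S)"
proof -
  have "good_paths S T P = (\<Union>e\<in>{e \<in> lists T. \<forall>\<omega>\<in>cyl S e. trace S \<omega> \<in> P}. cyl S e)"
    by (auto simp: good_paths_def)
  also have "\<dots> \<in> sets (path_measure S)"
    by (intro sets.countable_UN' countable_subset[OF _ countable_lists[OF assms]])
       (auto simp: cyl_measurable)
  finally show ?thesis .
qed

lemma sum_trans_prob_le_1:
  assumes "s \<in> states S" "finite F" "F \<subseteq> {t \<in> transitions S. source S t = s}"
  shows "sum (trans_prob S) F \<le> 1"
  using finite_sum_le_has_sum[OF trans_prob_has_sum[OF assms(1)] assms(2,3)] trans_prob_pos
  by (auto intro: less_imp_le)

end

section \<open>Monotonicity of negation-free LTL\<close>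

lemma sat_mono:
  assumes "sat \<phi> w" and "\<And>i. w !! i \<subseteq> w' !! i"
  shows "sat \<phi> w'"
  using assms
proof (induction \<phi> arbitrary: w w')
  \<comment> \<open>The only case that inspects letters, and it asks only for membership.\<close>
  case (Atom a)
  then show ?case using Atom.prems(2)[of 0] by auto
next
  case (Next \<phi>)
  show ?case
    using Next.prems Next.IH[of "stl w" "stl w'"] by (simp flip: snth.simps(2))
next
  case (Until \<phi> \<psi>)
  \<comment> \<open>\<open>w''\<close> ranges over the two subformulas. Pointwise inclusion passes
    to suffixes, so the induction hypotheses apply at every position \<open>k\<close>.\<close>
  have "w'' \<in> {\<phi>, \<psi>} \<Longrightarrow> sat w'' (sdrop k w) \<Longrightarrow> sat w'' (sdrop k w')" for w'' k
    using Until.IH[of "sdrop k w" "sdrop k w'"] Until.prems(2) by (auto simp: sdrop_snth)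
  then show ?case using Until.prems(1) by simp blast
next
  case (Release \<phi> \<psi>)
  have "w'' \<in> {\<phi>, \<psi>} \<Longrightarrow> sat w'' (sdrop k w) \<Longrightarrow> sat w'' (sdrop k w')" for w'' k
    using Release.IH[of "sdrop k w" "sdrop k w'"] Release.prems(2) by (auto simp: sdrop_snth)
  then show ?case using Release.prems(1) by simp blast
next
  case (And \<phi> \<psi>)
  then show ?case unfolding sat.simps by blast
next
  case (Or \<phi> \<psi>)
  then show ?case unfolding sat.simps by blast
qed simp_all

section \<open>The search system is itself an extension\<close>

locale pts_search = prob_transition_system AP S
  for AP :: "'a set" and S :: "('s, 't, 'a) pts" +
  fixes T :: "'t set"
  assumes search: "search S T"
begin

lemma finite_T: "finite T" and T_subset: "T \<subseteq> transitions S"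
  using search by (auto simp: search_def)

lemma search_states_subset: "search_states S T \<subseteq> states S"
  using T_subset by (auto simp: search_states_def source_in_states target_in_states init_in_states)

lemma out_le_1: "s \<in> search_states S T \<Longrightarrow> out S T s \<le> 1"
  unfolding out_def using search_states_subset finite_T T_subset by (intro sum_trans_prob_le_1) auto

lemma out_nonneg: "0 \<le> out S T s"
  unfolding out_def using T_subset trans_prob_pos by (intro sum_nonneg) (auto intro: less_imp_le)

lemma is_pts_search_pts: "is_pts AP (search_pts S T)"
proof -
  let ?S = "search_pts S T"
  have fin: "finite (search_states S T)"
    using finite_T by (auto simp: search_states_def)
  have "(trans_prob ?S has_sum 1) {t \<in> transitions ?S. source ?S t = x}" if "x \<in> states ?S" for x
  proof (cases x)
    case (State s)
    let ?A = "Trans ` {t \<in> T. source S t = s}"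
    have s: "s \<in> search_states S T"
      using that State by (auto simp: search_pts_def)
    have sum_A: "sum (trans_prob ?S) ?A = out S T s"
      by (simp add: search_pts_def out_def sum.reindex inj_on_def)
    show ?thesis
    proof (cases "out S T s < 1")
      case True
      \<comment> \<open>The exit supplies exactly the mass missing from
        \<open>out S T s\<close>.\<close>
      then have eq: "{t \<in> transitions ?S. source ?S t = x} = insert (Exit s) ?A"
        using s State by (auto simp: search_pts_def)
      have "sum (trans_prob ?S) (insert (Exit s) ?A) = 1"
        using finite_T sum_A by (subst sum.insert) (auto simp: search_pts_def)
      then show ?thesis
        unfolding eq using finite_T by (intro has_sum_finiteI) simp_all
    next
      case False
      then have eq: "{t \<in> transitions ?S. source ?S t = x} = ?A"
        using s State by (auto simp: search_pts_def)
      \<comment> \<open>Without an exit, the bound \<open>out_le_1\<close> forces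
        \<open>out S T s = 1\<close>.\<close>
      have "sum (trans_prob ?S) ?A = 1"
        using False out_le_1[OF s] sum_A by simp
      then show ?thesis
        unfolding eq using finite_T by (intro has_sum_finiteI) simp_all
    qed
  next
    case Sink
    then have eq: "{t \<in> transitions ?S. source ?S t = x} = {Loop}"
      by (auto simp: search_pts_def)
    show ?thesis
      unfolding eq by (rule has_sum_finiteI) (simp_all add: search_pts_def)
  next
    case FreshState
    then show ?thesis using that by (auto simp: search_pts_def)
  qed
  moreover have "countable (states ?S)" "countable (transitions ?S)" "init ?S \<in> states ?S"
    using fin finite_T by (auto simp: search_pts_def search_states_def intro!: countable_finite)
  \<comment> \<open>An exit has positive probability because it exists only for
    \<open>out S T s < 1\<close>; its bound by 1 is \<open>out_nonneg\<close>.\<close>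
  moreover have "source ?S t \<in> states ?S \<and> target ?S t \<in> states ?S \<and>
      0 < trans_prob ?S t \<and> trans_prob ?S t \<le> 1" if "t \<in> transitions ?S" for t
    using that T_subset is_pts out_nonneg
    by (auto simp: search_pts_def search_states_def is_pts_def)
  moreover have "label ?S s \<subseteq> AP" if "s \<in> states ?S" for s
    using that search_states_subset label_subset by (fastforce simp: search_pts_def)
  ultimately show ?thesis
    unfolding is_pts_def by blast
qed

lemma extends_search_pts: "extends (search_pts S T) S T"
  by (auto simp: extends_def search_pts_def)

end

section \<open>Comparison with an arbitrary extension\<close>

locale pts_extension = pts_search AP S T + ext: prob_transition_system AP S'
  for AP :: "'a set" and S :: "('s, 't, 'a) pts" and T :: "'t set"
    and S' :: "('s ext_state, ('s, 't) ext_trans, 'a) pts" +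
  assumes extends: "extends S' S T"
begin

lemma Trans_ext:
  assumes "t \<in> T"
  shows "Trans t \<in> transitions S'" "source S' (Trans t) = State (source S t)"
    "target S' (Trans t) = State (target S t)" "trans_prob S' (Trans t) = trans_prob S t"
    "label S' (State (source S t)) = label S (source S t)"
    "label S' (State (target S t)) = label S (target S t)"
  using extends assms by (auto simp: extends_def)

lemma init_ext: "init S' = State (init S)" and label_init_ext: "label S' (State (init S)) = label S (init S)"
  using extends by (auto simp: extends_def)

lemma label_ext: "s \<in> search_states S T \<Longrightarrow> label S' (State s) = label S s"
  using label_init_ext Trans_ext(5,6) by (auto simp: search_states_def)

text \<open>In \<open>S'\<close> the searched transitions already use the mass
  \<open>out S T s\<close> at \<open>State s\<close>, and \<open>t\<close> adds a positive amount to
  it within the total 1.\<close>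

lemma out_less_1:
  assumes t: "t \<in> transitions S'" "t \<notin> Trans ` T" and src: "source S' t = State s"
  shows "out S T s < 1"
proof -
  let ?A = "Trans ` {t \<in> T. source S t = s}"
  have "sum (trans_prob S') (insert t ?A) \<le> 1"
  proof (rule ext.sum_trans_prob_le_1)
    show "State s \<in> states S'"
      using ext.source_in_states[OF t(1)] src by simp
  qed (use t src finite_T Trans_ext in auto)
  moreover have "sum (trans_prob S') (insert t ?A) = trans_prob S' t + sum (trans_prob S') ?A"
    using t finite_T by (intro sum.insert) auto
  moreover have "sum (trans_prob S') ?A = out S T s"
    using Trans_ext(4) by (simp add: out_def sum.reindex inj_on_def)
  ultimately show ?thesis
    using ext.trans_prob_pos[OF t(1)] by simp
qed

text \<open>Follow \<open>\<omega>\<close> as long as it stays inside the search, then escape to the sink. The exit is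
  available because of the previous lemma.\<close>

lemma truncated_path:
  assumes \<omega>: "\<omega> \<in> exec S'"
  obtains \<omega>' where "\<omega>' \<in> exec (search_pts S T)"
    "\<And>i. (\<And>j. j \<le> i \<Longrightarrow> \<omega> !! j \<in> Trans ` T) \<Longrightarrow> \<omega>' !! i = \<omega> !! i"
    "\<And>i. trace (search_pts S T) \<omega>' !! i \<subseteq> trace S' \<omega> !! i"
proof -
  let ?S = "search_pts S T"
  \<comment> \<open>\<open>A i\<close>: no transition strictly before position \<open>i\<close> has
    left the search, so the state reached there is still a search state.\<close>
  define A where "A i \<longleftrightarrow> (\<forall>j<i. \<omega> !! j \<in> Trans ` T)" for i
  have A_Suc: "A (Suc i) \<longleftrightarrow> A i \<and> \<omega> !! i \<in> Trans ` T" for i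
    by (auto simp: A_def less_Suc_eq)
  have A_0: "A 0"
    by (simp add: A_def)
  have step: "\<omega> !! i \<in> transitions S'" "source S' (\<omega> !! Suc i) = target S' (\<omega> !! i)"
    and start: "source S' (\<omega> !! 0) = init S'" for i
    using \<omega> by (auto simp: exec_def streams_iff_snth)
  have src: "\<exists>s\<in>search_states S T. source S' (\<omega> !! i) = State s" if A: "A i" for i
  proof (cases i)
    case 0
    then show ?thesis using start init_ext by (auto simp: search_states_def)
  next
    case (Suc k)
    then obtain t where "t \<in> T" "\<omega> !! k = Trans t"
      using A A_Suc[of k] by auto
    then show ?thesis
      using Suc step(2)[of k] Trans_ext(3) by (auto simp: search_states_def simp del: snth.simps)
  qed
  \<comment> \<open>Copy, then exit once, then loop. \<open>THE\<close> strips the constructor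
    \<open>State\<close> from the current state to name its exit.\<close>
  define f where "f i = (if A (Suc i) then \<omega> !! i
    else if A i then Exit (THE s. source S' (\<omega> !! i) = State s) else Loop)" for i
  \<comment> \<open>Sources are governed by \<open>A i\<close> and targets by
    \<open>A (Suc i)\<close>, so consecutive transitions fit together.\<close>
  have f: "f i \<in> transitions ?S \<and> source ?S (f i) = (if A i then source S' (\<omega> !! i) else Sink) \<and>
      target ?S (f i) = (if A (Suc i) then target S' (\<omega> !! i) else Sink)" for i
  proof (cases "A i")
    case True
    then obtain s where s: "s \<in> search_states S T" "source S' (\<omega> !! i) = State s"
      using src by blast
    show ?thesis
    proof (cases "\<omega> !! i \<in> Trans ` T")
      case True
      then show ?thesis
        using \<open>A i\<close> Trans_ext by (auto simp: f_def A_Suc search_pts_def)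
    next
      case False
      then have "out S T s < 1"
        using step(1) s by (intro out_less_1) auto
      then show ?thesis
        using False \<open>A i\<close> s by (auto simp: f_def A_Suc search_pts_def)
    qed
  next
    case False
    then show ?thesis by (auto simp: f_def A_Suc search_pts_def)
  qed
  show ?thesis
  proof
    have "init ?S = init S'"
      by (simp add: search_pts_def init_ext)
    then have "source ?S (f 0) = init ?S"
      using f[of 0] A_0 start by simp
    moreover have "target ?S (f i) = source ?S (f (Suc i))" for i
      using f[of i] f[of "Suc i"] step(2)[of i] by simp
    ultimately show "to_stream f \<in> exec ?S"
      unfolding exec_def mem_Collect_eq to_stream_in_streams snth_to_stream snth.simps(1)[symmetric]
      using f by blast
    show "to_stream f !! i = \<omega> !! i" if "\<And>j. j \<le> i \<Longrightarrow> \<omega> !! j \<in> Trans ` T" for i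
      using that by (simp add: snth_to_stream f_def A_def)
    show "trace ?S (to_stream f) !! i \<subseteq> trace S' \<omega> !! i" for i
    proof (cases "A i")
      case True
      then obtain s where "s \<in> search_states S T" "source S' (\<omega> !! i) = State s"
        using src by blast
      then show ?thesis
        using f[of i] True label_ext
        by (auto simp: trace_def snth_to_stream search_pts_def)
    next
      case False
      \<comment> \<open>The sink has the empty label, which is below any label of
        \<open>S'\<close>.\<close>
      then have "source ?S (f i) = Sink"
        using f[of i] by simp
      then show ?thesis
        by (auto simp: trace_def snth_to_stream search_pts_def)
    qed
  qed
qed

lemma cyl_models_ext:
  assumes e: "e \<in> lists (Trans ` T)"
    and models: "\<And>\<omega>. \<omega> \<in> cyl (search_pts S T) e \<Longrightarrow> trace (search_pts S T) \<omega> \<in> models AP \<phi>"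
    and \<omega>: "\<omega> \<in> cyl S' e"
  shows "trace S' \<omega> \<in> models AP \<phi>"
proof -
  have exec: "\<omega> \<in> exec S'" and stake: "stake (length e) \<omega> = e"
    using \<omega> by (auto simp: cyl_def)
  obtain \<omega>' where \<omega>': "\<omega>' \<in> exec (search_pts S T)"
    "\<And>i. (\<And>j. j \<le> i \<Longrightarrow> \<omega> !! j \<in> Trans ` T) \<Longrightarrow> \<omega>' !! i = \<omega> !! i"
    "\<And>i. trace (search_pts S T) \<omega>' !! i \<subseteq> trace S' \<omega> !! i"
    using truncated_path[OF exec] by blast
  have "\<omega> !! i = e ! i" if "i < length e" for i
    using stake that by (simp add: stake_eq_iff_snth)
  moreover have "e ! i \<in> Trans ` T" if "i < length e" for i
    using e that by (auto simp: lists_eq_set)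
  ultimately have "\<omega>' !! i = e ! i" if "i < length e" for i
    using \<omega>'(2)[of i] that by auto
  \<comment> \<open>All letters of \<open>e\<close> are searched, so the truncation happens only
    after \<open>e\<close>.\<close>
  then have "\<omega>' \<in> cyl (search_pts S T) e"
    using \<omega>'(1) by (simp add: cyl_def stake_eq_iff_snth)
  then have "sat \<phi> (trace S' \<omega>)"
    using models \<omega>'(3) by (auto simp: models_def intro: sat_mono)
  \<comment> \<open>\<open>models\<close> also demands a word over subsets of \<open>AP\<close>,
    which the labelling of \<open>S'\<close> provides.\<close>
  moreover have "trace S' \<omega> \<in> streams (Pow AP)"
    using exec ext.label_subset ext.source_in_states
    by (fastforce simp: trace_def exec_def streams_iff_snth)
  ultimately show ?thesis
    by (simp add: models_def)
qed

lemma is_path_ext: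
  assumes "e \<in> lists (Trans ` T)" "is_path (search_pts S T) e"
  shows "is_path S' e"
proof -
  have T: "\<exists>t\<in>T. e ! i = Trans t" if "i < length e" for i
    using assms(1) that by (force simp: lists_eq_set dest: nth_mem)
  have "source S' (e ! i) = step_source S' i ((!) e)" if i: "i < length e" for i
  proof -
    have "source (search_pts S T) (e ! i) = step_source (search_pts S T) i ((!) e)"
      using assms(2) i by (simp add: is_path_def)
    then show ?thesis
      using T[OF i] T[of "i - 1"] i init_ext
      by (cases i) (auto simp: step_source_def search_pts_def Trans_ext)
  qed
  moreover have "e \<in> lists (transitions S')"
    using assms(1) Trans_ext(1) by auto
  ultimately show ?thesis by (simp add: is_path_def)
qed

lemma measure_good_paths_le:
  "measure (path_measure (search_pts S T)) (good_paths (search_pts S T) (Trans ` T) (models AP \<phi>))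
    \<le> measure (path_measure S') (good_paths S' (Trans ` T) (models AP \<phi>))"
proof -
  let ?S = "search_pts S T"
  interpret fin: prob_transition_system AP ?S
    by unfold_locales (rule is_pts_search_pts)
  interpret ext_path: prob_space "path_measure S'"
    by (rule ext.prob_space_path_measure)
  \<comment> \<open>Words that are not paths are vacuously good but have empty cylinders; dropping
    them keeps the union and makes \<open>emeasure_UN_cyl\<close> applicable.\<close>
  define E where "E = {e \<in> lists (Trans ` T). is_path ?S e \<and>
    (\<forall>\<omega>\<in>cyl ?S e. trace ?S \<omega> \<in> models AP \<phi>)}"
  have "good_paths ?S (Trans ` T) (models AP \<phi>) = (\<Union>e\<in>E. cyl ?S e)"
    by (auto simp: good_paths_def E_def fin.is_path_iff_prefix cyl_def)
  \<comment> \<open>Both sides become the same sum over the prefix-minimal words of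
    \<open>E\<close>, since searched transitions keep their probabilities.\<close>
  moreover have "emeasure (path_measure ?S) (\<Union>e\<in>E. cyl ?S e) =
      emeasure (path_measure S') (\<Union>e\<in>E. cyl S' e)"
  proof -
    have "(\<Prod>t\<leftarrow>e. trans_prob ?S t) = (\<Prod>t\<leftarrow>e. trans_prob S' t)" if "e \<in> E" for e
      using that Trans_ext(4)
      by (intro arg_cong[where f = prod_list] map_cong) (auto simp: E_def search_pts_def)
    then show ?thesis
      by (subst fin.emeasure_UN_cyl, simp add: E_def, subst ext.emeasure_UN_cyl)
         (auto simp: E_def is_path_ext intro!: nn_integral_cong)
  qed
  \<comment> \<open>Only an inclusion: larger labels beyond the search can make further words good
    in \<open>S'\<close>.\<close>
  moreover have "(\<Union>e\<in>E. cyl S' e) \<subseteq> good_paths S' (Trans ` T) (models AP \<phi>)"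
  proof (rule UN_least)
    fix e assume "e \<in> E"
    then have "e \<in> lists (Trans ` T) \<and> (\<forall>\<omega>\<in>cyl S' e. trace S' \<omega> \<in> models AP \<phi>)"
      unfolding E_def using cyl_models_ext[of e] by simp
    then show "cyl S' e \<subseteq> good_paths S' (Trans ` T) (models AP \<phi>)"
      unfolding good_paths_def by blast
  qed
  then have "measure (path_measure S') (\<Union>e\<in>E. cyl S' e) \<le>
      measure (path_measure S') (good_paths S' (Trans ` T) (models AP \<phi>))"
    using finite_T by (intro ext_path.finite_measure_mono ext.good_paths_measurable) (auto intro: countable_finite)
  ultimately show ?thesis
    by (simp add: measure_def)
qed

end

theorem theorem2:
  fixes AP :: "'a set" and S :: "('s, 't, 'a) pts" and T :: "'t set" and \<phi> :: "'a ltlp"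
  assumes "is_pts AP S"
    and "search S T"
    and "atoms \<phi> \<subseteq> AP"
  shows "prog AP S T (models AP \<phi>) =
    measure (path_measure (search_pts S T)) (good_paths (search_pts S T) (Trans ` T) (models AP \<phi>))"
proof -
  interpret pts_search AP S T
    by unfold_locales (use assms in auto)
  show ?thesis
    unfolding prog_def
  \<comment> \<open>The infimum is attained, at \<open>search_pts S T\<close>.\<close>
  proof (rule cInf_eq_minimum)
    show "measure (path_measure (search_pts S T)) (good_paths (search_pts S T) (Trans ` T) (models AP \<phi>))
      \<in> {measure (path_measure S') (good_paths S' (Trans ` T) (models AP \<phi>)) |S'.
          is_pts AP S' \<and> extends S' S T}"
      using is_pts_search_pts extends_search_pts by blast
  next
    fix x
    assume "x \<in> {measure (path_measure S') (good_paths S' (Trans ` T) (models AP \<phi>)) |S'.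
        is_pts AP S' \<and> extends S' S T}"
    then obtain S' where S': "is_pts AP S'" "extends S' S T"
      and x: "x = measure (path_measure S') (good_paths S' (Trans ` T) (models AP \<phi>))"
      by blast
    interpret pts_extension AP S T S'
      by unfold_locales (fact S')+
    show "measure (path_measure (search_pts S T)) (good_paths (search_pts S T) (Trans ` T) (models AP \<phi>)) \<le> x"
      unfolding x by (rule measure_good_paths_le)
  qed
qed

end
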